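(* Let $\lambda=(\lambda_1\ge\cdots\ge\lambda_n\ge0)$ be a partition with $n$ (possibly zero) parts. Then the Gelfand–Tsetlin polytope $\mathrm{GT}(\lambda)$ is integrally equivalent to the flow polytope $\mathcal{F}_{G_\lambda}$.
   Context: $\mathrm{GT}(\lambda)\subset\mathbb{R}^{\binom{n+1}{2}}$ is the set of nonnegative triangular arrays $(x_{ij})_{1\le i\le j\le n}$ with $x_{1j}=\lambda_j$ for $1\le j\le n$ and $x_{i-1,j-1}\ge x_{ij}\ge x_{i-1,j}$ for $2\le i\le j\le n$. Flow polytopes: for a finite directed acyclic multigraph $G$ and a netflow assignment $a\colon V(G)\to\mathbb{Z}$ with $\sum_v a(v)=0$, the flow polytope $\mathcal{F}_G=\mathcal{F}_G(a)$ is the set of $f\in\mathbb{R}_{\ge0}^{E(G)}$ such that for every vertex $v$, $\sum_{e\text{ into }v}f(e)+a(v)=\sum_{e\text{ out of }v}f(e)$. The flow network $G_\lambda$: if $n=1$, $G_\lambda$ is a single vertex and $\mathcal{F}_{G_\lambda}=\{0\}$. If $n\ge2$, $G_\lambda$ has vertices $v_{ij}$ ($2\le i\le j\le n$), $v_{i,i-1}$ ($3\le i\le n+2$), $v_{i,n+1}$ ($3\le i\le n+1$), and edges $(v_{ij},v_{i+1,j})$ for $2\le i\le j\le n$; $(v_{i,n+1},v_{i+1,n+1})$ for $3\le i\le n+1$; $(v_{ij},v_{i+1,j+1})$ for $2\le i\le j\le n$; $(v_{i,i-1},v_{i+1,i})$ for $3\le i\le n+1$. Netflow: $\lambda_{j-1}-\lambda_j$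 at $v_{2j}$ for $2\le j\le n$, $\lambda_n-\lambda_1$ at $v_{n+2,n+1}$, and $0$ at all other vertices. Two integral polytopes $\mathcal{P}\subset\mathbb{R}^d$, $\mathcal{Q}\subset\mathbb{R}^m$ are integrally equivalent if there is an affine map $\varphi\colon\mathbb{R}^d\to\mathbb{R}^m$ restricting to a bijection $\mathcal{P}\to\mathcal{Q}$ and to a bijection $\mathbb{Z}^d\cap\mathrm{aff}(\mathcal{P})\to\mathbb{Z}^m\cap\mathrm{aff}(\mathcal{Q})$. *)

theory Defs
  imports "HOL-Analysis.Analysis" "HOL-Analysis.Finite_Function_Topology" "Graph_Theory.Digraph"
begin

section \<open>Polytopes in coordinate spaces\<close>

text \<open>
  For a finite index set \<open>I\<close>, the space of real vectors indexed by \<open>I\<close> is the subspace of the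
  finitely supported functions whose support lies in \<open>I\<close>. This makes the library notions of
  linear map, convex hull and affine hull available although the dimension varies; hulls of subsets
  of \<open>coord_space I\<close> stay inside it, so they agree with the hulls taken in \<open>coord_space I\<close>.
\<close>

definition coord_space :: "'i set \<Rightarrow> ('i \<Rightarrow>\<^sub>0 real) set" where
  "coord_space I = {x. Poly_Mapping.keys x \<subseteq> I}"

definition coord_lattice :: "'i set \<Rightarrow> ('i \<Rightarrow>\<^sub>0 real) set" where
  "coord_lattice I = {x \<in> coord_space I. \<forall>i. Poly_Mapping.lookup x i \<in> \<int>}"

definition integral_polytope :: "'i set \<Rightarrow> ('i \<Rightarrow>\<^sub>0 real) set \<Rightarrow> bool" where
  "integral_polytope I P \<longleftrightarrow> (\<exists>V. finite V \<and> V \<subseteq> coord_lattice I \<and> P = convex hull V)"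

definition affine_map ::
    "'i set \<Rightarrow> 'j set \<Rightarrow> (('i \<Rightarrow>\<^sub>0 real) \<Rightarrow> ('j \<Rightarrow>\<^sub>0 real)) \<Rightarrow> bool" where
  "affine_map I J \<phi> \<longleftrightarrow>
     \<phi> \<in> coord_space I \<rightarrow> coord_space J \<and>
     (\<exists>L c. linear L \<and> (\<forall>x\<in>coord_space I. \<phi> x = L x + c))"

text \<open>
  Integral equivalence is only defined between integral polytopes; accordingly, asserting it
  includes that both sets are integral polytopes.
\<close>

definition integrally_equivalent ::
    "'i set \<Rightarrow> ('i \<Rightarrow>\<^sub>0 real) set \<Rightarrow> 'j set \<Rightarrow> ('j \<Rightarrow>\<^sub>0 real) set \<Rightarrow> bool" where
  "integrally_equivalent I P J Q \<longleftrightarrow>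
     integral_polytope I P \<and> integral_polytope J Q \<and>
     (\<exists>\<phi>. affine_map I J \<phi> \<and> bij_betw \<phi> P Q \<and>
          bij_betw \<phi> (coord_lattice I \<inter> affine hull P) (coord_lattice J \<inter> affine hull Q))"

section \<open>Gelfand--Tsetlin polytopes\<close>

definition GT_index :: "nat \<Rightarrow> (nat \<times> nat) set" where
  "GT_index n = {(i, j). 1 \<le> i \<and> i \<le> j \<and> j \<le> n}"

definition GT_polytope :: "nat \<Rightarrow> (nat \<Rightarrow> nat) \<Rightarrow> (nat \<times> nat \<Rightarrow>\<^sub>0 real) set" where
  "GT_polytope n lam = {x \<in> coord_space (GT_index n).
     (\<forall>(i, j) \<in> GT_index n. 0 \<le> Poly_Mapping.lookup x (i, j)) \<and>
     (\<forall>j. 1 \<le> j \<and> j \<le> n \<longrightarrow> Poly_Mapping.lookup x (1, j) = real (lam j)) \<and>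
     (\<forall>i j. 2 \<le> i \<and> i \<le> j \<and> j \<le> n \<longrightarrow>
        Poly_Mapping.lookup x (i - 1, j - 1) \<ge> Poly_Mapping.lookup x (i, j) \<and>
        Poly_Mapping.lookup x (i, j) \<ge> Poly_Mapping.lookup x (i - 1, j))}"

section \<open>Flow polytopes\<close>

definition flow_polytope :: "('v, 'e) pre_digraph \<Rightarrow> ('v \<Rightarrow> int) \<Rightarrow> ('e \<Rightarrow>\<^sub>0 real) set" where
  "flow_polytope G a = {f \<in> coord_space (arcs G).
     (\<forall>e \<in> arcs G. 0 \<le> Poly_Mapping.lookup f e) \<and>
     (\<forall>v \<in> verts G.
        (\<Sum>e \<in> in_arcs G v. Poly_Mapping.lookup f e) + real_of_int (a v) =
        (\<Sum>e \<in> out_arcs G v. Poly_Mapping.lookup f e))}"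

text \<open>
  The vertex with indices \<open>i, j\<close> is the pair \<open>(i, j)\<close>; the network has no parallel edges, so an edge
  is the pair of its endpoints.
\<close>

definition GT_network :: "nat \<Rightarrow> (nat \<times> nat, (nat \<times> nat) \<times> (nat \<times> nat)) pre_digraph" where
  "GT_network n =
    \<lparr> verts = {(i, j) | i j. 2 \<le> i \<and> i \<le> j \<and> j \<le> n}
            \<union> {(i, i - 1) | i. 3 \<le> i \<and> i \<le> n + 2}
            \<union> {(i, n + 1) | i. 3 \<le> i \<and> i \<le> n + 1},
      arcs = {((i, j), (i + 1, j)) | i j. 2 \<le> i \<and> i \<le> j \<and> j \<le> n}
           \<union> {((i, n + 1), (i + 1, n + 1)) | i. 3 \<le> i \<and> i \<le> n + 1}
           \<union> {((i, j), (i + 1, j + 1)) | i j. 2 \<le> i \<and> i \<le> j \<and> j \<le> n}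
           \<union> {((i, i - 1), (i + 1, i)) | i. 3 \<le> i \<and> i \<le> n + 1},
      tail = fst, head = snd \<rparr>"

definition GT_netflow :: "nat \<Rightarrow> (nat \<Rightarrow> nat) \<Rightarrow> nat \<times> nat \<Rightarrow> int" where
  "GT_netflow n lam = (\<lambda>(i, j).
     if i = 2 \<and> 2 \<le> j \<and> j \<le> n then int (lam (j - 1)) - int (lam j)
     else if i = n + 2 \<and> j = n + 1 then int (lam n) - int (lam 1)
     else 0)"

text \<open>
  The network meets the requirements for a flow polytope: it is a finite acyclic graph
  and the netflows sum to zero. For \<open>n = 1\<close> the general description degenerates to a single vertex
  without edges, whose flow polytope is the zero-dimensional space, so this case needs no separate
  definition.
\<close>

lemma fin_digraph_GT_network: "fin_digraph (GT_network n)"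
proof
  fix e assume "e \<in> arcs (GT_network n)"
  then show "tail (GT_network n) e \<in> verts (GT_network n)"
    by (auto simp: GT_network_def)
next
  fix e assume "e \<in> arcs (GT_network n)"
  then show "head (GT_network n) e \<in> verts (GT_network n)"
    by (auto simp: GT_network_def)
next
  have "verts (GT_network n) \<subseteq> {..n + 2} \<times> {..n + 2}"
    by (auto simp: GT_network_def)
  then show "finite (verts (GT_network n))"
    by (rule finite_subset) simp
  have "arcs (GT_network n) \<subseteq> ({..n + 2} \<times> {..n + 2}) \<times> ({..n + 2} \<times> {..n + 2})"
    by (auto simp: GT_network_def)
  then show "finite (arcs (GT_network n))"
    by (rule finite_subset) simp
qed

lemma acyclic_GT_network: "acyclic (arcs_ends (GT_network n))"
proof -
  have "(arcs_ends (GT_network n))\<inverse> \<subseteq> inv_image less_than (\<lambda>v. n + 2 - fst v)"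
    by (auto simp: arcs_ends_def arc_to_ends_def GT_network_def)
  then have "acyclic ((arcs_ends (GT_network n))\<inverse>)"
    by (meson acyclic_subset wf_acyclic wf_inv_image wf_less_than)
  then show ?thesis by simp
qed

lemma sum_GT_netflow:
  assumes "n \<ge> 1"
  shows "(\<Sum>v\<in>verts (GT_network n). GT_netflow n lam v) = 0"
proof -
  let ?A = "Pair 2 ` {2..n}" and ?t = "(n + 2, n + 1)"
  have tel: "(\<Sum>j=2..m. int (lam (j - 1)) - int (lam j)) = int (lam 1) - int (lam m)" if "1 \<le> m" for m
    using that by (induction m rule: dec_induct) (auto simp: numeral_2_eq_2)
  interpret fin_digraph "GT_network n" by (rule fin_digraph_GT_network)
  have "(\<Sum>v\<in>verts (GT_network n). GT_netflow n lam v) = (\<Sum>v\<in>insert ?t ?A. GT_netflow n lam v)"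
    using assms
    by (intro sum.mono_neutral_right finite_verts)
       (auto simp: GT_network_def GT_netflow_def split: if_splits)
  also have "\<dots> = GT_netflow n lam ?t + (\<Sum>v\<in>?A. GT_netflow n lam v)"
    using assms by (subst sum.insert) auto
  also have "(\<Sum>v\<in>?A. GT_netflow n lam v) = (\<Sum>j=2..n. int (lam (j - 1)) - int (lam j))"
    by (subst sum.reindex) (auto simp: inj_on_def GT_netflow_def intro!: sum.cong)
  also have "\<dots> = int (lam 1) - int (lam n)" using tel[OF assms] .
  finally show ?thesis using assms by (simp add: GT_netflow_def)
qed

lemma GT_network_1:
  "verts (GT_network 1) = {(3, 2)}" "arcs (GT_network 1) = {}"
  "flow_polytope (GT_network 1) (GT_netflow 1 lam) = {0}"
proof -
  show v: "verts (GT_network 1) = {(3, 2)}" and a: "arcs (GT_network 1) = {}"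
    by (auto simp: GT_network_def)
  show "flow_polytope (GT_network 1) (GT_netflow 1 lam) = {0}"
    unfolding flow_polytope_def in_arcs_def out_arcs_def v a
    by (auto simp: coord_space_def GT_netflow_def)
qed

end

theory Submission
  imports Defs
begin

text \<open>
  The equivalence sends an array to the flow whose values are the slacks of the interlacing
  inequalities, with \<open>x\<^sub>1\<^sub>1 - x\<^sub>i\<^sub>i\<close> and \<open>x\<^sub>i\<^sub>n - x\<^sub>1\<^sub>n\<close> on the two boundary paths. Conservation is then an
  identity, and a flow is inverted by adding up its diagonal arcs down each column, starting from
  the fixed top row; both directions have integer coefficients. Integrality of the
  Gelfand--Tsetlin polytope holds because its constraints only compare coordinates with each other
  and with integers, so they survive every monotone rounding that fixes the integers; the map
  carries integrality over to the flow polytope.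
\<close>

section \<open>Coordinates of finitely supported vectors\<close>

lemma lookup_scaleR_poly_mapping:
  fixes x :: "'i \<Rightarrow>\<^sub>0 real"
  shows "Poly_Mapping.lookup (r *\<^sub>R x) i = r * Poly_Mapping.lookup x i"
proof -
  have "finite {i. r * Poly_Mapping.lookup x i \<noteq> 0}"
    by (rule finite_subset[OF _ finite_lookup[of x]]) auto
  then show ?thesis by (simp add: scaleR_poly_mapping_def)
qed

text \<open>\<open>Poly_Mapping.map\<close> acts on the support only and leaves zeros at zero, hence
  the condition on \<open>g\<close>.\<close>

lemma lookup_map_fix_zero:
  assumes "g 0 = 0"
  shows "Poly_Mapping.lookup (Poly_Mapping.map g x) i = g (Poly_Mapping.lookup x i)"
  using assms by (simp add: map.rep_eq when_def)

lemma coord_space_iff: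
  "x \<in> coord_space I \<longleftrightarrow> (\<forall>i. i \<notin> I \<longrightarrow> Poly_Mapping.lookup x i = 0)"
  by (auto simp: coord_space_def in_keys_iff)

lemma coord_spaceD: "x \<in> coord_space I \<Longrightarrow> i \<notin> I \<Longrightarrow> Poly_Mapping.lookup x i = 0"
  by (simp add: coord_space_iff del: split_paired_All)

lemma lookup_Abs_when:
  assumes "finite A"
  shows "Poly_Mapping.lookup (Abs_poly_mapping (\<lambda>i. f i when i \<in> A)) i = (f i when i \<in> A)"
proof -
  have "finite {i. (f i when i \<in> A) \<noteq> 0}"
    by (rule finite_subset[OF _ assms]) auto
  then show ?thesis by simp
qed

section \<open>Integrality by monotone rounding\<close>

text \<open>The values need not be integers: besides the ceiling, the partial roundings that stretch
  part of each unit interval must qualify.\<close>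

definition monotone_rounding :: "(real \<Rightarrow> real) \<Rightarrow> bool" where
  "monotone_rounding g \<longleftrightarrow> mono g \<and> (\<forall>m::int. g (of_int m) = of_int m)"

lemma monotone_rounding_ceiling: "monotone_rounding (\<lambda>t. of_int \<lceil>t\<rceil>)"
  by (auto simp: monotone_rounding_def intro!: monoI ceiling_mono)

lemma monotone_rounding_zero: "monotone_rounding g \<Longrightarrow> g 0 = 0"
  unfolding monotone_rounding_def by (metis of_int_0)

text \<open>On each interval from \<open>m\<close> to \<open>m + 1\<close>, the initial piece of
  length \<open>r\<close> collapses to \<open>m\<close> and the rest is stretched linearly over the
  whole interval.\<close>

lemma monotone_rounding_compress:
  assumes "0 < r" "r < 1"
  shows "monotone_rounding (\<lambda>t. of_int \<lfloor>t\<rfloor> + max 0 (frac t - r) / (1 - r))"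
  unfolding monotone_rounding_def
proof (intro conjI monoI allI)
  fix s t :: real assume st: "s \<le> t"
  \<comment> \<open>The image of a unit interval stays below its right end, so order is kept between
    arguments with different floors.\<close>
  have lt: "max 0 (frac s - r) / (1 - r) < 1"
    using assms frac_lt_1[of s] by (simp add: divide_simps max_def)
  show "of_int \<lfloor>s\<rfloor> + max 0 (frac s - r) / (1 - r) \<le> of_int \<lfloor>t\<rfloor> + max 0 (frac t - r) / (1 - r)"
  proof (cases "\<lfloor>s\<rfloor> = \<lfloor>t\<rfloor>")
    case True
    then have "frac s \<le> frac t" using st by (simp add: frac_def)
    then show ?thesis using True assms by (auto intro!: divide_right_mono)
  next
    case False
    then have "\<lfloor>s\<rfloor> + 1 \<le> \<lfloor>t\<rfloor>" using floor_mono[OF st] by linarith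
    then have "real_of_int \<lfloor>s\<rfloor> + 1 \<le> of_int \<lfloor>t\<rfloor>" by linarith
    moreover have "0 \<le> max 0 (frac t - r) / (1 - r)" using assms by simp
    ultimately show ?thesis using lt by linarith
  qed
qed (use assms in auto)

text \<open>
  With \<open>r\<close> the least positive fractional part of \<open>x\<close>, the point \<open>x\<close> lies on the segment from its
  ceiling to a point with fewer fractional parts, and both ends are monotone roundings of \<open>x\<close>.
\<close>

lemma in_convex_hull_lattice_points:
  fixes P :: "('i \<Rightarrow>\<^sub>0 real) set"
  assumes closed: "\<And>x g. x \<in> P \<Longrightarrow> monotone_rounding g \<Longrightarrow> Poly_Mapping.map g x \<in> P"
    and sub: "P \<subseteq> coord_space I"
    and "x \<in> P"
  shows "x \<in> convex hull (P \<inter> coord_lattice I)"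
proof -
  \<comment> \<open>The induction is on the number of distinct positive fractional parts of the
    coordinates.\<close>
  define S where "S x = frac ` range (Poly_Mapping.lookup x) - {0}" for x :: "'i \<Rightarrow>\<^sub>0 real"
  have finS: "finite (S x)" for x :: "'i \<Rightarrow>\<^sub>0 real"
  proof -
    \<comment> \<open>Only the finitely many nonzero coordinates can contribute, so \<open>I\<close>
      may be infinite here.\<close>
    have "S x \<subseteq> frac ` Poly_Mapping.lookup x ` {i. Poly_Mapping.lookup x i \<noteq> 0}"
    proof
      fix s assume "s \<in> S x"
      then obtain i where "s = frac (Poly_Mapping.lookup x i)" "s \<noteq> 0" by (auto simp: S_def)
      then have "Poly_Mapping.lookup x i \<noteq> 0" by auto
      with \<open>s = _\<close> show "s \<in> frac ` Poly_Mapping.lookup x ` {i. Poly_Mapping.lookup x i \<noteq> 0}"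
        by blast
    qed
    then show ?thesis by (rule finite_subset) simp
  qed
  show ?thesis
    using \<open>x \<in> P\<close>
  proof (induction "card (S x)" arbitrary: x rule: less_induct)
    case less
    show ?case
    proof (cases "S x = {}")
      case True
      then have "frac (Poly_Mapping.lookup x i) = 0" for i unfolding S_def by blast
      then have "x \<in> coord_lattice I"
        using less.prems sub by (auto simp: coord_lattice_def)
      then show ?thesis using less.prems by (simp add: hull_inc)
    next
      case False
      define r where "r = Min (S x)"
      have rS: "r \<in> S x" using False finS by (simp add: r_def)
      then have "r \<ge> 0" "r \<noteq> 0" "r < 1" by (auto simp: S_def frac_lt_1)
      then have r: "0 < r" "r < 1" by auto
      have rmin: "frac (Poly_Mapping.lookup x i) = 0 \<or> r \<le> frac (Poly_Mapping.lookup x i)" for i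
        using Min_le[OF finS[of x], of "frac (Poly_Mapping.lookup x i)"]
        by (auto simp: S_def r_def)
      define g where "g t = of_int \<lfloor>t\<rfloor> + max 0 (frac t - r) / (1 - r)" for t
      have g: "monotone_rounding g" unfolding g_def by (rule monotone_rounding_compress[OF r])
      define z :: "'i \<Rightarrow>\<^sub>0 real" where "z = Poly_Mapping.map (\<lambda>t. of_int \<lceil>t\<rceil>) x"
      define w where "w = Poly_Mapping.map g x"
      have z: "Poly_Mapping.lookup z i = of_int \<lceil>Poly_Mapping.lookup x i\<rceil>" for i
        by (simp add: z_def lookup_map_fix_zero)
      have w: "Poly_Mapping.lookup w i = g (Poly_Mapping.lookup x i)" for i
        using monotone_rounding_zero[OF g] by (simp add: w_def lookup_map_fix_zero)
      have zP: "z \<in> P" and wP: "w \<in> P"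
        unfolding z_def w_def using closed less.prems monotone_rounding_ceiling g by blast+
      have "z \<in> coord_lattice I" using zP sub by (auto simp: coord_lattice_def z)
      then have zh: "z \<in> convex hull (P \<inter> coord_lattice I)" using zP by (simp add: hull_inc)
      have frac_g: "frac (g t) = max 0 (frac t - r) / (1 - r)" for t
      proof -
        have "max 0 (frac t - r) / (1 - r) \<in> {0..<1}"
          using r frac_lt_1[of t] by (simp add: divide_simps max_def)
        then show ?thesis by (simp add: g_def)
      qed
      \<comment> \<open>Fractional parts equal to \<open>r\<close> become 0 and the larger ones are
        rescaled injectively, so at least one value disappears.\<close>
      have "S w \<subseteq> (\<lambda>f. (f - r) / (1 - r)) ` (S x - {r})"
      proof
        fix s assume "s \<in> S w"
        then obtain i where i: "s = frac (g (Poly_Mapping.lookup x i))" "s \<noteq> 0"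
          by (auto simp: S_def w)
        let ?f = "frac (Poly_Mapping.lookup x i)"
        have "?f > r" and s: "s = (?f - r) / (1 - r)"
          using i r by (auto simp: frac_g max_def split: if_splits)
        then have "?f \<noteq> 0" "?f \<noteq> r" using r(1) by linarith+
        then have "?f \<in> S x - {r}" unfolding S_def by blast
        then show "s \<in> (\<lambda>f. (f - r) / (1 - r)) ` (S x - {r})" using s by blast
      qed
      then have "card (S w) \<le> card (S x - {r})"
        using finS by (meson card_image_le card_mono finite_Diff finite_imageI le_trans)
      also have "\<dots> < card (S x)" using rS finS by (rule card_Diff1_less[rotated])
      finally have wh: "w \<in> convex hull (P \<inter> coord_lattice I)" using less.hyps wP by blast
      have "x = r *\<^sub>R z + (1 - r) *\<^sub>R w"
      proof (rule poly_mapping_eqI)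
        fix i
        let ?t = "Poly_Mapping.lookup x i"
        \<comment> \<open>For a non-integral coordinate the ceiling is the floor plus 1; the surplus
          \<open>r\<close> from the first term cancels the \<open>r\<close> subtracted inside
          \<open>g\<close>.\<close>
        have "?t = r * of_int \<lceil>?t\<rceil> + (1 - r) * g ?t"
        proof (cases "frac ?t = 0")
          case True
          then obtain m where "?t = of_int m" by (auto elim: Ints_cases)
          then show ?thesis using r by (simp add: g_def algebra_simps)
        next
          case False
          then have "r \<le> frac ?t" "\<lceil>?t\<rceil> = \<lfloor>?t\<rfloor> + 1"
            using rmin[of i] by (auto simp: ceiling_altdef frac_def)
          moreover from this have "(1 - r) * g ?t = (1 - r) * of_int \<lfloor>?t\<rfloor> + (frac ?t - r)"
            using r by (simp add: g_def distrib_left)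
          ultimately show ?thesis by (simp add: frac_def algebra_simps)
        qed
        then show "Poly_Mapping.lookup x i = Poly_Mapping.lookup (r *\<^sub>R z + (1 - r) *\<^sub>R w) i"
          by (simp add: lookup_add lookup_scaleR_poly_mapping z w)
      qed
      then show ?thesis
        using convexD[OF convex_convex_hull zh wh, of r "1 - r"] r by simp
    qed
  qed
qed

lemma finite_bounded_lattice_points:
  fixes I :: "'i set"
  assumes "finite I"
  shows "finite {x \<in> coord_lattice I. \<forall>i. \<bar>Poly_Mapping.lookup x i\<bar> \<le> B}"
proof -
  let ?K = "real_of_int ` {-\<lceil>B\<rceil>..\<lceil>B\<rceil>}"
  have "Poly_Mapping.lookup ` {x \<in> coord_lattice I. \<forall>i. \<bar>Poly_Mapping.lookup x i\<bar> \<le> B} \<subseteq>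
    {f. \<forall>i. (i \<in> I \<longrightarrow> f i \<in> ?K) \<and> (i \<notin> I \<longrightarrow> f i = 0)}"
  proof clarsimp
    fix x :: "'i \<Rightarrow>\<^sub>0 real" and i
    assume x: "x \<in> coord_lattice I" and B: "\<forall>i. \<bar>Poly_Mapping.lookup x i\<bar> \<le> B"
    obtain m where m: "Poly_Mapping.lookup x i = of_int m"
      using x by (auto simp: coord_lattice_def elim: Ints_cases)
    have "\<bar>real_of_int m\<bar> \<le> B" using B m by metis
    then have "m \<in> {-\<lceil>B\<rceil>..\<lceil>B\<rceil>}" by (auto simp: abs_le_iff) linarith+
    then show "(i \<in> I \<longrightarrow> Poly_Mapping.lookup x i \<in> ?K) \<and> (i \<notin> I \<longrightarrow> Poly_Mapping.lookup x i = 0)"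
      using m x by (auto simp: coord_lattice_def coord_space_iff)
  qed
  moreover have "finite {f. \<forall>i. (i \<in> I \<longrightarrow> f i \<in> ?K) \<and> (i \<notin> I \<longrightarrow> f i = 0)}"
    using assms by (intro finite_set_of_finite_funs) auto
  ultimately have "finite (Poly_Mapping.lookup ` {x \<in> coord_lattice I. \<forall>i. \<bar>Poly_Mapping.lookup x i\<bar> \<le> B})"
    by (rule finite_subset)
  then show ?thesis by (rule finite_imageD) (simp add: inj_on_def)
qed

text \<open>All lattice points of \<open>P\<close> serve as the generating set: boundedness makes
  them finitely many, and closure under rounding makes their hull exhaust \<open>P\<close>.\<close>

lemma integral_polytopeI:
  fixes P :: "('i \<Rightarrow>\<^sub>0 real) set"
  assumes "\<And>x g. x \<in> P \<Longrightarrow> monotone_rounding g \<Longrightarrow> Poly_Mapping.map g x \<in> P"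
    and "P \<subseteq> coord_space I" and "finite I" and "convex P"
    and "\<And>x i. x \<in> P \<Longrightarrow> \<bar>Poly_Mapping.lookup x i\<bar> \<le> B"
  shows "integral_polytope I P"
  unfolding integral_polytope_def
proof (intro exI conjI)
  show "finite (P \<inter> coord_lattice I)"
    using assms(5)
    by (intro finite_subset[OF _ finite_bounded_lattice_points[OF assms(3), of B]]) auto
  show "P = convex hull (P \<inter> coord_lattice I)"
  proof
    show "P \<subseteq> convex hull (P \<inter> coord_lattice I)"
      using in_convex_hull_lattice_points[OF assms(1,2)] by blast
    show "convex hull (P \<inter> coord_lattice I) \<subseteq> P"
      using assms(4) by (simp add: hull_minimal)
  qed
qed simp

section \<open>The Gelfand--Tsetlin polytope\<close>

lemma finite_GT_index: "finite (GT_index n)"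
  by (rule finite_subset[of _ "{..n} \<times> {..n}"]) (auto simp: GT_index_def)

lemma GT_interlace:
  assumes "x \<in> GT_polytope n lam" "1 \<le> i" "i \<le> j" "j < n"
  shows "Poly_Mapping.lookup x (Suc i, Suc j) \<le> Poly_Mapping.lookup x (i, j)"
    and "Poly_Mapping.lookup x (i, Suc j) \<le> Poly_Mapping.lookup x (Suc i, Suc j)"
proof -
  have *: "2 \<le> Suc i \<and> Suc i \<le> Suc j \<and> Suc j \<le> n \<longrightarrow>
      Poly_Mapping.lookup x (Suc i, Suc j) \<le> Poly_Mapping.lookup x (Suc i - 1, Suc j - 1) \<and>
      Poly_Mapping.lookup x (Suc i - 1, Suc j) \<le> Poly_Mapping.lookup x (Suc i, Suc j)"
    using assms(1) unfolding GT_polytope_def by blast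
  show "Poly_Mapping.lookup x (Suc i, Suc j) \<le> Poly_Mapping.lookup x (i, j)"
    and "Poly_Mapping.lookup x (i, Suc j) \<le> Poly_Mapping.lookup x (Suc i, Suc j)"
    using * assms(2-) by auto
qed

lemma GT_top_row:
  assumes "x \<in> GT_polytope n lam" "1 \<le> j" "j \<le> n"
  shows "Poly_Mapping.lookup x (1, j) = real (lam j)"
  using assms by (simp add: GT_polytope_def)

text \<open>Chains one half of the interlacing inequalities along a diagonal. It bounds the entries
  from above and, for \<open>d = 0\<close>, makes the flow on the left boundary path
  nonnegative.\<close>

lemma GT_diagonal_le:
  assumes "x \<in> GT_polytope n lam" "1 \<le> i" "i + d \<le> n"
  shows "Poly_Mapping.lookup x (i, i + d) \<le> Poly_Mapping.lookup x (1, 1 + d)"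
  using assms(2,3)
proof (induction i rule: dec_induct)
  case (step k)
  have "Poly_Mapping.lookup x (Suc k, Suc (k + d)) \<le> Poly_Mapping.lookup x (k, k + d)"
    using GT_interlace(1)[OF assms(1)] step.hyps step.prems by simp
  then show ?case using step by simp
qed simp

text \<open>Chains the other half down a column; the last column gives nonnegativity on the right
  boundary path.\<close>

lemma GT_column_ge:
  assumes "x \<in> GT_polytope n lam" "1 \<le> i" "i \<le> j" "j \<le> n"
  shows "Poly_Mapping.lookup x (1, j) \<le> Poly_Mapping.lookup x (i, j)"
  using assms(2,3)
proof (induction i rule: dec_induct)
  case (step k)
  obtain j' where "j = Suc j'" using step.prems by (cases j) auto
  then have "Poly_Mapping.lookup x (k, j) \<le> Poly_Mapping.lookup x (Suc k, j)"
    using GT_interlace(2)[OF assms(1), of k j'] assms(4) step.hyps step.prems by simp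
  then show ?case using step by simp
qed simp

lemma integral_GT_polytope: "integral_polytope (GT_index n) (GT_polytope n lam)"
proof (rule integral_polytopeI)
  fix x g assume x: "x \<in> GT_polytope n lam" and g: "monotone_rounding g"
  have g0: "g 0 = 0" by (rule monotone_rounding_zero[OF g])
  have gn: "g (real m) = real m" for m
    using g unfolding monotone_rounding_def by (metis of_int_of_nat_eq)
  have gm: "s \<le> t \<Longrightarrow> g s \<le> g t" for s t using g by (auto simp: monotone_rounding_def mono_def)
  have g_nonneg: "0 \<le> t \<Longrightarrow> 0 \<le> g t" for t using gm[of 0 t] g0 by simp
  show "Poly_Mapping.map g x \<in> GT_polytope n lam"
    using x unfolding GT_polytope_def
    by (auto simp: lookup_map_fix_zero g0 gn coord_space_iff intro!: gm g_nonneg)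
next
  fix x i assume x: "x \<in> GT_polytope n lam"
  show "\<bar>Poly_Mapping.lookup x i\<bar> \<le> (\<Sum>j=1..n. real (lam j))"
  proof (cases "i \<in> GT_index n")
    case True
    \<comment> \<open>Writing the index as \<open>(k, k + d)\<close> exposes its diagonal, which is
      followed up to the top row; the sum of all parts is a crude bound for whichever part is met
      there.\<close>
    then obtain k d where i: "i = (k, k + d)" "1 \<le> k" "k + d \<le> n"
      by (auto simp: GT_index_def nat_le_iff_add)
    have "Poly_Mapping.lookup x i \<le> Poly_Mapping.lookup x (1, 1 + d)"
      using GT_diagonal_le[OF x] i by simp
    also have "\<dots> = real (lam (1 + d))" using x i by (simp add: GT_polytope_def)
    also have "\<dots> \<le> (\<Sum>j=1..n. real (lam j))" using i by (intro member_le_sum) auto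
    finally show ?thesis using x True by (force simp: GT_polytope_def)
  next
    case False
    moreover have "x \<in> coord_space (GT_index n)" using x by (simp add: GT_polytope_def)
    ultimately have "Poly_Mapping.lookup x i = 0" by (rule coord_spaceD[rotated])
    then show ?thesis by (simp add: sum_nonneg)
  qed
next
  show "convex (GT_polytope n lam)"
  proof (rule convexI)
    fix x y :: "nat \<times> nat \<Rightarrow>\<^sub>0 real" and u v :: real
    assume uv: "0 \<le> u" "0 \<le> v" "u + v = 1"
      and xy: "x \<in> GT_polytope n lam" "y \<in> GT_polytope n lam"
    have "u * c + v * c = c" for c using uv(3) by (metis distrib_right mult_1)
    then show "u *\<^sub>R x + v *\<^sub>R y \<in> GT_polytope n lam"
      using uv xy unfolding GT_polytope_def
      by (auto simp: coord_space_iff lookup_add lookup_scaleR_poly_mapping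
          intro!: add_mono mult_left_mono add_nonneg_nonneg mult_nonneg_nonneg)
  qed
qed (auto simp: GT_polytope_def finite_GT_index)

section \<open>The equivalence with the flow polytope\<close>

text \<open>
  The indices of the network are shifted by one, so that the arcs out of row \<open>i + 1\<close> correspond to
  the inequalities between rows \<open>i\<close> and \<open>i + 1\<close> of the array.
\<close>

abbreviation vert_arc :: "nat \<Rightarrow> nat \<Rightarrow> (nat \<times> nat) \<times> (nat \<times> nat)" where
  "vert_arc i j \<equiv> ((Suc i, Suc j), (Suc (Suc i), Suc j))"

abbreviation diag_arc :: "nat \<Rightarrow> nat \<Rightarrow> (nat \<times> nat) \<times> (nat \<times> nat)" where
  "diag_arc i j \<equiv> ((Suc i, Suc j), (Suc (Suc i), Suc (Suc j)))"

abbreviation left_arc :: "nat \<Rightarrow> (nat \<times> nat) \<times> (nat \<times> nat)" where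
  "left_arc i \<equiv> ((Suc (Suc i), Suc i), (Suc (Suc (Suc i)), Suc (Suc i)))"

abbreviation right_arc :: "nat \<Rightarrow> nat \<Rightarrow> (nat \<times> nat) \<times> (nat \<times> nat)" where
  "right_arc n i \<equiv> ((Suc (Suc i), Suc n), (Suc (Suc (Suc i)), Suc n))"

section \<open>Arcs of the network and its conservation equations\<close>

lemma GT_arc_cases:
  assumes "e \<in> arcs (GT_network n)"
  obtains (vert) i j where "e = vert_arc i j" "1 \<le> i" "i \<le> j" "j < n"
    | (diag) i j where "e = diag_arc i j" "1 \<le> i" "i \<le> j" "j < n"
    | (left) i where "e = left_arc i" "1 \<le> i" "i < n"
    | (right) i where "e = right_arc n i" "1 \<le> i" "i < n"
proof -
  have shift: "\<exists>i'. i = Suc i' \<and> 1 \<le> i'" if "2 \<le> i" for i :: nat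
    using that by (intro exI[of _ "i - 1"]) auto
  have shift2: "\<exists>i'. i = Suc (Suc i') \<and> 1 \<le> i'" if "3 \<le> i" for i :: nat
    using that by (intro exI[of _ "i - 2"]) auto
  consider (a) i j where "e = ((i, j), (i + 1, j))" "2 \<le> i" "i \<le> j" "j \<le> n"
    | (b) i where "e = ((i, n + 1), (i + 1, n + 1))" "3 \<le> i" "i \<le> n + 1"
    | (c) i j where "e = ((i, j), (i + 1, j + 1))" "2 \<le> i" "i \<le> j" "j \<le> n"
    | (d) i where "e = ((i, i - 1), (i + 1, i))" "3 \<le> i" "i \<le> n + 1"
    using assms unfolding GT_network_def by auto
  then show thesis
  proof cases
    case a
    then obtain i' j' where "i = Suc i'" "1 \<le> i'" "j = Suc j'" using shift[of i] shift[of j] by auto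
    with a show thesis using vert[of i' j'] by simp
  next
    case b
    then obtain i' where "i = Suc (Suc i')" "1 \<le> i'" using shift2[of i] by auto
    with b show thesis using right[of i'] by simp
  next
    case c
    then obtain i' j' where "i = Suc i'" "1 \<le> i'" "j = Suc j'" using shift[of i] shift[of j] by auto
    with c show thesis using diag[of i' j'] by simp
  next
    case d
    then obtain i' where "i = Suc (Suc i')" "1 \<le> i'" using shift2[of i] by auto
    with d show thesis using left[of i'] by simp
  qed
qed

lemma GT_arcs:
  "1 \<le> i \<Longrightarrow> i \<le> j \<Longrightarrow> j < n \<Longrightarrow> vert_arc i j \<in> arcs (GT_network n)"
  "1 \<le> i \<Longrightarrow> i \<le> j \<Longrightarrow> j < n \<Longrightarrow> diag_arc i j \<in> arcs (GT_network n)"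
  "1 \<le> i \<Longrightarrow> i < n \<Longrightarrow> left_arc i \<in> arcs (GT_network n)"
  "1 \<le> i \<Longrightarrow> i < n \<Longrightarrow> right_arc n i \<in> arcs (GT_network n)"
  by (simp_all add: GT_network_def)

lemma GT_tail_head [simp]: "tail (GT_network n) = fst" "head (GT_network n) = snd"
  by (simp_all add: GT_network_def)

lemma out_arcs_GT_network:
  assumes "1 \<le> i" "i < n"
  shows "i \<le> j \<Longrightarrow> j < n \<Longrightarrow> out_arcs (GT_network n) (Suc i, Suc j) = {vert_arc i j, diag_arc i j}"
    and "out_arcs (GT_network n) (Suc (Suc i), Suc i) = {left_arc i}"
    and "out_arcs (GT_network n) (Suc (Suc i), Suc n) = {right_arc n i}"
  unfolding out_arcs_def using assms
  by (auto elim!: GT_arc_cases intro: GT_arcs)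

lemma in_arcs_GT_network:
  assumes "1 < n"
  shows "in_arcs (GT_network n) (2, Suc j) = {}"
    and "1 \<le> i \<Longrightarrow> i \<le> j \<Longrightarrow> Suc j < n \<Longrightarrow>
      in_arcs (GT_network n) (Suc (Suc i), Suc (Suc j)) = {vert_arc i (Suc j), diag_arc i j}"
    and "in_arcs (GT_network n) (3, 2) = {vert_arc 1 1}"
    and "1 \<le> i \<Longrightarrow> Suc i < n \<Longrightarrow>
      in_arcs (GT_network n) (Suc (Suc (Suc i)), Suc (Suc i)) = {vert_arc (Suc i) (Suc i), left_arc i}"
    and "in_arcs (GT_network n) (3, Suc n) = {diag_arc 1 (n - 1)}"
    and "1 \<le> i \<Longrightarrow> Suc i < n \<Longrightarrow>
      in_arcs (GT_network n) (Suc (Suc (Suc i)), Suc n) = {diag_arc (Suc i) (n - 1), right_arc n i}"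
    and "in_arcs (GT_network n) (Suc (Suc n), Suc n) = {left_arc (n - 1), right_arc n (n - 1)}"
proof -
  \<comment> \<open>These are \<open>diag_arc i (n - 1)\<close>, \<open>left_arc (n - 1)\<close> and
    \<open>right_arc n (n - 1)\<close>, in the form they take once \<open>Suc (n - 1)\<close> is
    simplified to \<open>n\<close>.\<close>
  have boundary: "1 \<le> i \<Longrightarrow> i < n \<Longrightarrow> ((Suc i, n), (Suc (Suc i), Suc n)) \<in> arcs (GT_network n)"
    "((Suc n, n), (Suc (Suc n), Suc n)) \<in> arcs (GT_network n)"
    "((Suc n, Suc n), (Suc (Suc n), Suc n)) \<in> arcs (GT_network n)" for i
    using assms by (auto simp: GT_network_def)
  show "in_arcs (GT_network n) (2, Suc j) = {}"
    and "1 \<le> i \<Longrightarrow> i \<le> j \<Longrightarrow> Suc j < n \<Longrightarrow>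
      in_arcs (GT_network n) (Suc (Suc i), Suc (Suc j)) = {vert_arc i (Suc j), diag_arc i j}"
    and "in_arcs (GT_network n) (3, 2) = {vert_arc 1 1}"
    and "1 \<le> i \<Longrightarrow> Suc i < n \<Longrightarrow>
      in_arcs (GT_network n) (Suc (Suc (Suc i)), Suc (Suc i)) = {vert_arc (Suc i) (Suc i), left_arc i}"
    unfolding in_arcs_def using assms
    by (auto elim!: GT_arc_cases intro: GT_arcs simp: numeral_2_eq_2 numeral_3_eq_3)
  show "in_arcs (GT_network n) (3, Suc n) = {diag_arc 1 (n - 1)}"
  proof
    show "in_arcs (GT_network n) (3, Suc n) \<subseteq> {diag_arc 1 (n - 1)}"
      unfolding in_arcs_def by (auto elim!: GT_arc_cases simp: numeral_3_eq_3)
    show "{diag_arc 1 (n - 1)} \<subseteq> in_arcs (GT_network n) (3, Suc n)"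
      unfolding in_arcs_def using boundary(1)[of 1] assms by (simp add: numeral_3_eq_3)
  qed
  show "in_arcs (GT_network n) (Suc (Suc (Suc i)), Suc n) = {diag_arc (Suc i) (n - 1), right_arc n i}"
    if "1 \<le> i" "Suc i < n"
  proof
    show "in_arcs (GT_network n) (Suc (Suc (Suc i)), Suc n) \<subseteq> {diag_arc (Suc i) (n - 1), right_arc n i}"
      unfolding in_arcs_def using that by (auto elim!: GT_arc_cases)
    show "{diag_arc (Suc i) (n - 1), right_arc n i} \<subseteq> in_arcs (GT_network n) (Suc (Suc (Suc i)), Suc n)"
      unfolding in_arcs_def using boundary(1)[of "Suc i"] GT_arcs(4)[of i n] that by simp
  qed
  show "in_arcs (GT_network n) (Suc (Suc n), Suc n) = {left_arc (n - 1), right_arc n (n - 1)}"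
  proof
    show "in_arcs (GT_network n) (Suc (Suc n), Suc n) \<subseteq> {left_arc (n - 1), right_arc n (n - 1)}"
      unfolding in_arcs_def by (auto elim!: GT_arc_cases)
    show "{left_arc (n - 1), right_arc n (n - 1)} \<subseteq> in_arcs (GT_network n) (Suc (Suc n), Suc n)"
      unfolding in_arcs_def using boundary(2,3) assms by simp
  qed
qed

text \<open>Stated for arbitrary arc values, so that it serves both to verify conservation for the
  image of an array and to extract equations from a given flow. The equations are ordered by vertex:
  top row, interior, left path, right path, sink.\<close>

lemma GT_conservation_iff:
  fixes F :: "(nat \<times> nat) \<times> (nat \<times> nat) \<Rightarrow> real"
  assumes "1 < n"
  shows "(\<forall>v \<in> verts (GT_network n).
        (\<Sum>e \<in> in_arcs (GT_network n) v. F e) + real_of_int (GT_netflow n lam v) =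
        (\<Sum>e \<in> out_arcs (GT_network n) v. F e)) \<longleftrightarrow>
    (\<forall>j. 1 \<le> j \<and> j < n \<longrightarrow> real (lam j) - real (lam (Suc j)) = F (vert_arc 1 j) + F (diag_arc 1 j)) \<and>
    (\<forall>i j. 1 \<le> i \<and> i \<le> j \<and> Suc j < n \<longrightarrow>
      F (vert_arc i (Suc j)) + F (diag_arc i j) =
      F (vert_arc (Suc i) (Suc j)) + F (diag_arc (Suc i) (Suc j))) \<and>
    F (vert_arc 1 1) = F (left_arc 1) \<and>
    (\<forall>i. 1 \<le> i \<and> Suc i < n \<longrightarrow>
      F (vert_arc (Suc i) (Suc i)) + F (left_arc i) = F (left_arc (Suc i))) \<and>
    F (diag_arc 1 (n - 1)) = F (right_arc n 1) \<and>
    (\<forall>i. 1 \<le> i \<and> Suc i < n \<longrightarrow>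
      F (diag_arc (Suc i) (n - 1)) + F (right_arc n i) = F (right_arc n (Suc i))) \<and>
    F (left_arc (n - 1)) + F (right_arc n (n - 1)) = real (lam 1) - real (lam n)"
  (is "?L \<longleftrightarrow> ?R")
proof -
  let ?C = "\<lambda>v. (\<Sum>e \<in> in_arcs (GT_network n) v. F e) + real_of_int (GT_netflow n lam v) =
        (\<Sum>e \<in> out_arcs (GT_network n) v. F e)"
  have pred: "\<exists>k. i = Suc k" if "0 < i" for i :: nat
    using that by (cases i) auto
  \<comment> \<open>The first vertex of each boundary path is listed separately, since no path arc
    enters it.\<close>
  have verts: "verts (GT_network n) =
      {(2, Suc j) |j. 1 \<le> j \<and> j < n} \<union>
      {(Suc (Suc i), Suc (Suc j)) |i j. 1 \<le> i \<and> i \<le> j \<and> Suc j < n} \<union>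
      {(3, 2)} \<union> {(Suc (Suc (Suc i)), Suc (Suc i)) |i. 1 \<le> i \<and> Suc i < n} \<union>
      {(3, Suc n)} \<union> {(Suc (Suc (Suc i)), Suc n) |i. 1 \<le> i \<and> Suc i < n} \<union>
      {(Suc (Suc n), Suc n)}" (is "_ = ?V")
  proof
    show "?V \<subseteq> verts (GT_network n)" using assms by (auto simp: GT_network_def)
    show "verts (GT_network n) \<subseteq> ?V"
    proof
      fix v assume "v \<in> verts (GT_network n)"
      then consider (a) i j where "v = (i, j)" "2 \<le> i" "i \<le> j" "j \<le> n"
        | (b) i where "v = (i, i - 1)" "3 \<le> i" "i \<le> n + 2"
        | (c) i where "v = (i, n + 1)" "3 \<le> i" "i \<le> n + 1"
        unfolding GT_network_def by auto
      then show "v \<in> ?V"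
      proof cases
        case a
        then show ?thesis
          using pred[of j] pred[of "j - 1"] pred[of "i - 1"] pred[of i]
          by (cases "i = 2") auto
      next
        case b
        then have "i = 3 \<or> i = Suc (Suc n) \<or> (\<exists>k. i = Suc (Suc (Suc k)) \<and> 1 \<le> k \<and> Suc k < n)"
          by presburger
        then show ?thesis using b by auto
      next
        case c
        then have "i = 3 \<or> (\<exists>k. i = Suc (Suc (Suc k)) \<and> 1 \<le> k \<and> Suc k < n)"
          by presburger
        then show ?thesis using c by auto
      qed
    qed
  qed
  have top: "?C (2, Suc j) \<longleftrightarrow>
      real (lam j) - real (lam (Suc j)) = F (vert_arc 1 j) + F (diag_arc 1 j)" if "1 \<le> j" "j < n" for j
    using that assms in_arcs_GT_network(1)[OF assms] out_arcs_GT_network(1)[of 1 n j]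
    by (simp add: GT_netflow_def numeral_2_eq_2)
  have inner: "?C (Suc (Suc i), Suc (Suc j)) \<longleftrightarrow>
      F (vert_arc i (Suc j)) + F (diag_arc i j) =
      F (vert_arc (Suc i) (Suc j)) + F (diag_arc (Suc i) (Suc j))"
    if "1 \<le> i" "i \<le> j" "Suc j < n" for i j
    using that by (simp add: GT_netflow_def in_arcs_GT_network(2) out_arcs_GT_network(1))
  have left1: "?C (3, 2) \<longleftrightarrow> F (vert_arc 1 1) = F (left_arc 1)"
    using assms in_arcs_GT_network(3)[OF assms] out_arcs_GT_network(2)[of 1 n]
    by (simp add: GT_netflow_def numeral_2_eq_2 numeral_3_eq_3)
  have left: "?C (Suc (Suc (Suc i)), Suc (Suc i)) \<longleftrightarrow>
      F (vert_arc (Suc i) (Suc i)) + F (left_arc i) = F (left_arc (Suc i))"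
    if "1 \<le> i" "Suc i < n" for i
    using that by (simp add: GT_netflow_def in_arcs_GT_network(4) out_arcs_GT_network(2))
  have right1: "?C (3, Suc n) \<longleftrightarrow> F (diag_arc 1 (n - 1)) = F (right_arc n 1)"
    using assms in_arcs_GT_network(5)[OF assms] out_arcs_GT_network(3)[of 1 n]
    by (simp add: GT_netflow_def numeral_2_eq_2 numeral_3_eq_3)
  have right: "?C (Suc (Suc (Suc i)), Suc n) \<longleftrightarrow>
      F (diag_arc (Suc i) (n - 1)) + F (right_arc n i) = F (right_arc n (Suc i))"
    if "1 \<le> i" "Suc i < n" for i
    using that by (simp add: GT_netflow_def in_arcs_GT_network(6) out_arcs_GT_network(3))
  have "out_arcs (GT_network n) (Suc (Suc n), Suc n) = {}"
    unfolding out_arcs_def by (auto elim!: GT_arc_cases)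
  then have sink: "?C (Suc (Suc n), Suc n) \<longleftrightarrow>
      F (left_arc (n - 1)) + F (right_arc n (n - 1)) = real (lam 1) - real (lam n)"
    using assms by (auto simp: GT_netflow_def in_arcs_GT_network(7))
  have "?L \<longleftrightarrow> (\<forall>j. 1 \<le> j \<and> j < n \<longrightarrow> ?C (2, Suc j)) \<and>
    (\<forall>i j. 1 \<le> i \<and> i \<le> j \<and> Suc j < n \<longrightarrow> ?C (Suc (Suc i), Suc (Suc j))) \<and>
    ?C (3, 2) \<and> (\<forall>i. 1 \<le> i \<and> Suc i < n \<longrightarrow> ?C (Suc (Suc (Suc i)), Suc (Suc i))) \<and>
    ?C (3, Suc n) \<and> (\<forall>i. 1 \<le> i \<and> Suc i < n \<longrightarrow> ?C (Suc (Suc (Suc i)), Suc n)) \<and>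
    ?C (Suc (Suc n), Suc n)"
    unfolding verts by blast
  also have "\<dots> \<longleftrightarrow> ?R"
    unfolding left1 right1 sink using top inner left right by auto
  finally show ?thesis .
qed

section \<open>Linear images and integral equivalence\<close>

lemma affine_hull_image_linear:
  assumes "linear L"
  shows "affine hull (L ` S) = L ` (affine hull S)"
proof
  interpret linear L by fact
  have "affine (L ` (affine hull S))"
    unfolding affine_def[of "L ` (affine hull S)"]
  proof (intro ballI allI impI)
    fix p q and u v :: real
    assume "p \<in> L ` (affine hull S)" "q \<in> L ` (affine hull S)" and uv: "u + v = 1"
    then obtain x y where xy: "x \<in> affine hull S" "y \<in> affine hull S" "p = L x" "q = L y" by blast
    then have "u *\<^sub>R x + v *\<^sub>R y \<in> affine hull S"
      using uv affine_affine_hull[of S] unfolding affine_def by blast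
    moreover have "u *\<^sub>R p + v *\<^sub>R q = L (u *\<^sub>R x + v *\<^sub>R y)"
      using xy by (simp add: add scale)
    ultimately show "u *\<^sub>R p + v *\<^sub>R q \<in> L ` (affine hull S)" by (metis imageI)
  qed
  then show "affine hull (L ` S) \<subseteq> L ` (affine hull S)"
    by (intro hull_minimal image_mono hull_subset)
  \<comment> \<open>For the reverse inclusion, the preimage of an affine set under a linear map is
    affine.\<close>
  have "affine (L -` (affine hull (L ` S)))"
    using affine_affine_hull[of "L ` S"] unfolding affine_def by (simp add: add scale)
  then have "affine hull S \<subseteq> L -` (affine hull (L ` S))"
    by (intro hull_minimal) (auto intro: hull_inc)
  then show "L ` (affine hull S) \<subseteq> affine hull (L ` S)" by blast
qed

text \<open>Integrality of the target need not be checked separately: lattice generators of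
  \<open>P\<close> lie in its affine hull, so \<open>L\<close> sends them to lattice generators of
  the image.\<close>

lemma integrally_equivalent_linear_image:
  assumes P: "integral_polytope I P" and L: "linear L"
    and map: "\<And>x. L x \<in> coord_space J"
    and inj: "inj_on L (affine hull P)"
    and lattice: "\<And>x. x \<in> affine hull P \<Longrightarrow> x \<in> coord_lattice I \<longleftrightarrow> L x \<in> coord_lattice J"
  shows "integrally_equivalent I P J (L ` P)"
  unfolding integrally_equivalent_def
proof (intro conjI exI)
  obtain V where V: "finite V" "V \<subseteq> coord_lattice I" "P = convex hull V"
    using P by (auto simp: integral_polytope_def)
  have "V \<subseteq> affine hull P"
    unfolding V(3) by (meson hull_subset order_trans)
  then have "L ` V \<subseteq> coord_lattice J" using V(2) lattice by blast
  moreover have "L ` P = convex hull (L ` V)" using V(3) L by (simp add: convex_hull_linear_image)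
  ultimately show "integral_polytope J (L ` P)" using V(1) by (auto simp: integral_polytope_def)
  show "affine_map I J L"
    unfolding affine_map_def using map L by (auto intro!: exI[of _ L] exI[of _ 0])
  show "bij_betw L P (L ` P)"
    using inj by (meson hull_subset inj_on_imp_bij_betw inj_on_subset)
  have "L ` (coord_lattice I \<inter> affine hull P) = coord_lattice J \<inter> affine hull (L ` P)"
    unfolding affine_hull_image_linear[OF L] using lattice by blast
  then show "bij_betw L (coord_lattice I \<inter> affine hull P) (coord_lattice J \<inter> affine hull (L ` P))"
    using inj by (auto simp: bij_betw_def intro: inj_on_subset)
qed (rule P)

section \<open>The slack map from arrays to flows\<close>

definition arc_value :: "nat \<Rightarrow> (nat \<times> nat \<Rightarrow> real) \<Rightarrow> (nat \<times> nat) \<times> (nat \<times> nat) \<Rightarrow> real" where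
  "arc_value n X = (\<lambda>((i, j), (i', j')).
     if j = Suc n then X (i - 1, n) - X (1, n)
     else if j < i then X (1, 1) - X (i - 1, i - 1)
     else if j' = j then X (i - 1, j - 1) - X (i, j)
     else X (i, j) - X (i - 1, j))"

text \<open>The order of the tests in \<open>arc_value\<close> matters: right arcs keep their column
  like vertical ones, and left arcs change it like diagonal ones, so both boundary types are
  recognised first. Row \<open>i + 1\<close> of the network belongs to row \<open>i\<close> of the
  array.\<close>

lemma arc_value_simps:
  "i \<le> j \<Longrightarrow> j < n \<Longrightarrow> arc_value n X (vert_arc i j) = X (i, j) - X (Suc i, Suc j)"
  "i \<le> j \<Longrightarrow> j < n \<Longrightarrow> arc_value n X (diag_arc i j) = X (Suc i, Suc j) - X (i, Suc j)"
  "i < n \<Longrightarrow> arc_value n X (left_arc i) = X (1, 1) - X (Suc i, Suc i)"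
  "arc_value n X (right_arc n i) = X (Suc i, n) - X (1, n)"
  by (simp_all add: arc_value_def)

definition GT_flow :: "nat \<Rightarrow> (nat \<times> nat \<Rightarrow>\<^sub>0 real) \<Rightarrow> ((nat \<times> nat) \<times> (nat \<times> nat) \<Rightarrow>\<^sub>0 real)" where
  "GT_flow n x = Abs_poly_mapping (\<lambda>e. arc_value n (Poly_Mapping.lookup x) e when e \<in> arcs (GT_network n))"

lemma lookup_GT_flow:
  "Poly_Mapping.lookup (GT_flow n x) e =
    (arc_value n (Poly_Mapping.lookup x) e when e \<in> arcs (GT_network n))"
proof -
  interpret fin_digraph "GT_network n" by (rule fin_digraph_GT_network)
  show ?thesis unfolding GT_flow_def by (rule lookup_Abs_when) (rule finite_arcs)
qed

lemma lookup_GT_flow_arc: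
  assumes "1 \<le> i"
  shows "i \<le> j \<Longrightarrow> j < n \<Longrightarrow> Poly_Mapping.lookup (GT_flow n x) (vert_arc i j) =
      Poly_Mapping.lookup x (i, j) - Poly_Mapping.lookup x (Suc i, Suc j)"
    and "i \<le> j \<Longrightarrow> j < n \<Longrightarrow> Poly_Mapping.lookup (GT_flow n x) (diag_arc i j) =
      Poly_Mapping.lookup x (Suc i, Suc j) - Poly_Mapping.lookup x (i, Suc j)"
    and "i < n \<Longrightarrow> Poly_Mapping.lookup (GT_flow n x) (left_arc i) =
      Poly_Mapping.lookup x (1, 1) - Poly_Mapping.lookup x (Suc i, Suc i)"
    and "i < n \<Longrightarrow> Poly_Mapping.lookup (GT_flow n x) (right_arc n i) =
      Poly_Mapping.lookup x (Suc i, n) - Poly_Mapping.lookup x (1, n)"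
  using assms by (simp_all only: lookup_GT_flow GT_arcs arc_value_simps when_simps)

lemma linear_GT_flow: "linear (GT_flow n)"
proof (rule linearI)
  fix x y :: "nat \<times> nat \<Rightarrow>\<^sub>0 real" and r :: real
  show "GT_flow n (x + y) = GT_flow n x + GT_flow n y"
    by (rule poly_mapping_eqI)
      (auto simp: lookup_GT_flow lookup_add when_def arc_value_def split: prod.splits)
  show "GT_flow n (r *\<^sub>R x) = r *\<^sub>R GT_flow n x"
    by (rule poly_mapping_eqI)
      (auto simp: lookup_GT_flow lookup_scaleR_poly_mapping when_def arc_value_def right_diff_distrib
        split: prod.splits)
qed

text \<open>Interlacing and its chains give nonnegativity; in each conservation equation the slacks
  telescope, and the fixed top row accounts for the supplies and the demand.\<close>

lemma GT_flow_in_flow_polytope: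
  assumes "1 < n" and x: "x \<in> GT_polytope n lam"
  shows "GT_flow n x \<in> flow_polytope (GT_network n) (GT_netflow n lam)"
proof -
  let ?X = "Poly_Mapping.lookup x"
  have "0 \<le> Poly_Mapping.lookup (GT_flow n x) e" if "e \<in> arcs (GT_network n)" for e
    using that
  proof (cases rule: GT_arc_cases)
    case (vert i j)
    then show ?thesis using GT_interlace(1)[OF x, of i j] by (simp add: lookup_GT_flow_arc)
  next
    case (diag i j)
    then show ?thesis using GT_interlace(2)[OF x, of i j] by (simp add: lookup_GT_flow_arc)
  next
    case (left i)
    then show ?thesis using GT_diagonal_le[OF x, of "Suc i" 0] by (simp add: lookup_GT_flow_arc)
  next
    case (right i)
    then show ?thesis using GT_column_ge[OF x, of "Suc i" n] by (simp add: lookup_GT_flow_arc)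
  qed
  moreover have "\<forall>v \<in> verts (GT_network n).
        (\<Sum>e \<in> in_arcs (GT_network n) v. Poly_Mapping.lookup (GT_flow n x) e) + real_of_int (GT_netflow n lam v) =
        (\<Sum>e \<in> out_arcs (GT_network n) v. Poly_Mapping.lookup (GT_flow n x) e)"
  proof -
    have row: "?X (Suc 0, j) = real (lam j)" if "1 \<le> j" "j \<le> n" for j
      using GT_top_row[OF x that] by simp
    show ?thesis
      unfolding GT_conservation_iff[OF assms(1)]
    proof (intro conjI allI impI)
      \<comment> \<open>The equations at the right path and the sink mention \<open>n - 1\<close>;
        naming it \<open>m\<close> lets the slack formulas apply directly.\<close>
      obtain m where m: "n = Suc m" "1 \<le> m" using assms(1) by (cases n) auto
      let ?F = "Poly_Mapping.lookup (GT_flow n x)"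
      show "?F (diag_arc 1 (n - 1)) = ?F (right_arc n 1)"
        using lookup_GT_flow_arc(2)[of 1 m n x] lookup_GT_flow_arc(4)[of 1 n x] m by simp
      show "?F (left_arc (n - 1)) + ?F (right_arc n (n - 1)) = real (lam 1) - real (lam n)"
        using lookup_GT_flow_arc(3)[of m n x] lookup_GT_flow_arc(4)[of m n x] m row by simp
      show "?F (diag_arc (Suc i) (n - 1)) + ?F (right_arc n i) = ?F (right_arc n (Suc i))"
        if "1 \<le> i \<and> Suc i < n" for i
        using lookup_GT_flow_arc(2)[of "Suc i" m n x] lookup_GT_flow_arc(4)[of i n x]
          lookup_GT_flow_arc(4)[of "Suc i" n x] m that by simp
    qed (use assms in \<open>simp_all add: lookup_GT_flow_arc row\<close>)
  qed
  ultimately show ?thesis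
    unfolding flow_polytope_def by (auto simp: coord_space_iff lookup_GT_flow)
qed

lemma flow_polytope_subset_GT_flow_image:
  assumes "1 < n" and f: "f \<in> flow_polytope (GT_network n) (GT_netflow n lam)"
  shows "f \<in> GT_flow n ` GT_polytope n lam"
proof -
  let ?F = "Poly_Mapping.lookup f"
  have f_space: "f \<in> coord_space (arcs (GT_network n))"
    using f by (simp add: flow_polytope_def)
  \<comment> \<open>The inverse: column \<open>j\<close> starts at \<open>lam j\<close> and grows by
    the diagonal flows down that column. The formula for diagonal arcs then holds by
    construction.\<close>
  define x where "x = Abs_poly_mapping (\<lambda>p.
    (case p of (i, j) \<Rightarrow> real (lam j) + (\<Sum>k\<in>{1..<i}. ?F (diag_arc k (j - 1)))) when p \<in> GT_index n)"
  define X where "X = Poly_Mapping.lookup x"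
  have X: "X (i, j) = (real (lam j) + (\<Sum>k\<in>{1..<i}. ?F (diag_arc k (j - 1))) when (i, j) \<in> GT_index n)" for i j
    unfolding X_def x_def by (subst lookup_Abs_when) (simp_all add: finite_GT_index)
  have X1: "X (1, j) = real (lam j)" if "1 \<le> j" "j \<le> n" for j
    using that by (simp add: X GT_index_def)
  have diag: "?F (diag_arc i j) = X (Suc i, Suc j) - X (i, Suc j)" if "1 \<le> i" "i \<le> j" "j < n" for i j
    using that by (simp add: X GT_index_def)
  \<comment> \<open>Off the arcs the flow is 0, so later sums need no check that their terms are
    arcs.\<close>
  have nonneg: "0 \<le> ?F e" for e
    using f coord_spaceD[OF f_space, of e] by (cases "e \<in> arcs (GT_network n)") (auto simp: flow_polytope_def)
  have "\<forall>v \<in> verts (GT_network n).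
        (\<Sum>e \<in> in_arcs (GT_network n) v. ?F e) + real_of_int (GT_netflow n lam v) =
        (\<Sum>e \<in> out_arcs (GT_network n) v. ?F e)"
    using f by (simp add: flow_polytope_def)
  note cons = this[unfolded GT_conservation_iff[OF assms(1)]]
  \<comment> \<open>Row by row: conservation at the vertex between two rows expresses each vertical
    flow by the vertical flow above it and two diagonal flows, all already known.\<close>
  have vert: "?F (vert_arc i j) = X (i, j) - X (Suc i, Suc j)" if "1 \<le> i" "i \<le> j" "j < n" for i j
    using that
  proof (induction i arbitrary: j rule: dec_induct)
    case base
    then have "real (lam j) - real (lam (Suc j)) = ?F (vert_arc 1 j) + ?F (diag_arc 1 j)"
      using cons by blast
    then show ?case using diag[of 1 j] X1[of j] X1[of "Suc j"] base by simp
  next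
    case (step i)
    obtain j' where j: "j = Suc j'" using step.prems by (cases j) auto
    have "?F (vert_arc i (Suc j')) + ?F (diag_arc i j') =
      ?F (vert_arc (Suc i) (Suc j')) + ?F (diag_arc (Suc i) (Suc j'))"
      using cons step.hyps step.prems j by simp
    then show ?case
      using step.IH[of j] diag[of i j'] diag[of "Suc i" j] step.hyps step.prems j by simp
  qed
  have left: "?F (left_arc i) = X (1, 1) - X (Suc i, Suc i)" if "1 \<le> i" "i < n" for i
    using that
  proof (induction i rule: dec_induct)
    case base
    then show ?case using cons vert[of 1 1] by simp
  next
    case (step i)
    then have "?F (vert_arc (Suc i) (Suc i)) + ?F (left_arc i) = ?F (left_arc (Suc i))"
      using cons by blast
    then show ?case using step vert[of "Suc i" "Suc i"] by simp
  qed
  \<comment> \<open>Along either boundary path, each vertex adds one incoming slack to the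
    accumulated flow.\<close>
  have right: "?F (right_arc n i) = X (Suc i, n) - X (1, n)" if "1 \<le> i" "i < n" for i
    using that
  proof (induction i rule: dec_induct)
    case base
    have "?F (diag_arc 1 (n - 1)) = ?F (right_arc n 1)" using cons by blast
    then show ?case using diag[of 1 "n - 1"] base by simp
  next
    case (step i)
    then have "?F (diag_arc (Suc i) (n - 1)) + ?F (right_arc n i) = ?F (right_arc n (Suc i))"
      using cons by blast
    then show ?case using step diag[of "Suc i" "n - 1"] by simp
  qed
  have "f = GT_flow n x"
  proof (rule poly_mapping_eqI)
    fix e
    show "?F e = Poly_Mapping.lookup (GT_flow n x) e"
    proof (cases "e \<in> arcs (GT_network n)")
      case True
      then show ?thesis
        by (cases rule: GT_arc_cases)
          (simp_all add: lookup_GT_flow_arc vert[unfolded X_def] diag[unfolded X_def]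
            left[unfolded X_def] right[unfolded X_def])
    next
      case False
      then show ?thesis using f_space by (simp add: lookup_GT_flow coord_spaceD)
    qed
  qed
  moreover have "x \<in> GT_polytope n lam"
  proof -
    have "x \<in> coord_space (GT_index n)"
      by (auto simp: coord_space_iff X_def[symmetric] X)
    moreover have "\<forall>(i, j)\<in>GT_index n. 0 \<le> X (i, j)"
      by (auto simp: X intro!: add_nonneg_nonneg sum_nonneg nonneg)
    \<comment> \<open>The two interlacing inequalities are nonnegativity of one vertical and one
      diagonal arc.\<close>
    moreover have "X (i, j) \<le> X (i - 1, j - 1) \<and> X (i - 1, j) \<le> X (i, j)"
      if ij: "2 \<le> i" "i \<le> j" "j \<le> n" for i j
    proof -
      obtain i' j' where "i = Suc i'" "j = Suc j'" using ij by (cases i; cases j) auto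
      then show ?thesis
        using vert[of i' j'] nonneg[of "vert_arc i' j'"] diag[of i' j'] nonneg[of "diag_arc i' j'"] ij
        by simp
    qed
    ultimately show ?thesis
      unfolding GT_polytope_def using X1 by (simp add: X_def)
  qed
  ultimately show ?thesis by blast
qed

lemma GT_flow_image:
  assumes "1 \<le> n"
  shows "GT_flow n ` GT_polytope n lam = flow_polytope (GT_network n) (GT_netflow n lam)"
proof (cases "n = 1")
  case True
  \<comment> \<open>With no arcs the map is constantly 0; a point of the polytope is needed for the
    image to be \<open>{0}\<close> and not empty.\<close>
  have point: "Poly_Mapping.single (1, 1) (real (lam 1)) \<in> GT_polytope n lam"
    using True by (auto simp: GT_polytope_def coord_space_iff GT_index_def lookup_single when_def)
  have "GT_flow n x = 0" for x
  proof (rule poly_mapping_eqI)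
    show "Poly_Mapping.lookup (GT_flow n x) e = Poly_Mapping.lookup 0 e" for e
      unfolding lookup_GT_flow True GT_network_1(2) by simp
  qed
  then have "GT_flow n ` GT_polytope n lam = (\<lambda>_. 0) ` GT_polytope n lam"
    by (intro image_cong refl)
  then have "GT_flow n ` GT_polytope n lam = {0}"
    unfolding image_constant[OF point] .
  then show ?thesis unfolding True GT_network_1(3) .
next
  case False
  then have "1 < n" using assms by simp
  then show ?thesis
    using GT_flow_in_flow_polytope flow_polytope_subset_GT_flow_image by blast
qed

section \<open>Recovering arrays on the affine hull\<close>

lemma affine_hull_GT_polytope:
  assumes "x \<in> affine hull (GT_polytope n lam)"
  shows "x \<in> coord_space (GT_index n)"
    and "\<lbrakk>1 \<le> j; j \<le> n\<rbrakk> \<Longrightarrow> Poly_Mapping.lookup x (1, j) = real (lam j)"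
proof -
  \<comment> \<open>The inequalities are lost on the affine hull, so only linear equations are
    retained. \<open>?E\<close> may be larger than the hull, for instance when parts coincide, but
    it fixes the top row, which is all that the inversion uses.\<close>
  let ?E = "{x \<in> coord_space (GT_index n). \<forall>j. 1 \<le> j \<and> j \<le> n \<longrightarrow> Poly_Mapping.lookup x (1, j) = real (lam j)}"
  have "affine ?E"
    unfolding affine_def
    by (auto simp: coord_space_iff lookup_add lookup_scaleR_poly_mapping simp flip: distrib_right)
  then have "affine hull (GT_polytope n lam) \<subseteq> ?E"
    by (intro hull_minimal) (auto simp: GT_polytope_def)
  then show "x \<in> coord_space (GT_index n)"
    and "\<lbrakk>1 \<le> j; j \<le> n\<rbrakk> \<Longrightarrow> Poly_Mapping.lookup x (1, j) = real (lam j)"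
    using assms by auto
qed

text \<open>
  Since the top row is constant on the affine hull, each column is recovered from it by adding up
  the flows on the diagonal arcs.
\<close>

lemma GT_entry_eq_sum:
  assumes "x \<in> affine hull (GT_polytope n lam)" "1 \<le> i" "i \<le> j" "j \<le> n"
  shows "Poly_Mapping.lookup x (i, j) =
    real (lam j) + (\<Sum>k\<in>{1..<i}. Poly_Mapping.lookup (GT_flow n x) (diag_arc k (j - 1)))"
  using assms(2,3)
proof (induction i rule: dec_induct)
  case base
  then show ?case using affine_hull_GT_polytope(2)[OF assms(1), of j] assms(4) by simp
next
  case (step i)
  then show ?case using lookup_GT_flow_arc(2)[of i "j - 1" n x] assms(4) by simp
qed

theorem theorem1p2:
  fixes n :: nat and lam :: "nat \<Rightarrow> nat"
  assumes "n \<ge> 1"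
    and "\<forall>j\<in>{1..<n}. lam j \<ge> lam (j + 1)"
  shows "integrally_equivalent
           (GT_index n) (GT_polytope n lam)
           (arcs (GT_network n)) (flow_polytope (GT_network n) (GT_netflow n lam))"
  unfolding GT_flow_image[OF assms(1), symmetric]
\<comment> \<open>With the flow polytope rewritten as an image, it remains to compare injectivity
  and lattice points on the affine hull.\<close>
proof (rule integrally_equivalent_linear_image[OF integral_GT_polytope linear_GT_flow])
  show "GT_flow n x \<in> coord_space (arcs (GT_network n))" for x
    by (simp add: coord_space_iff lookup_GT_flow)
  show "inj_on (GT_flow n) (affine hull GT_polytope n lam)"
  proof (rule inj_onI, rule poly_mapping_eqI)
    fix x y p
    assume xy: "x \<in> affine hull GT_polytope n lam" "y \<in> affine hull GT_polytope n lam"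
      "GT_flow n x = GT_flow n y"
    show "Poly_Mapping.lookup x p = Poly_Mapping.lookup y p"
    proof (cases "p \<in> GT_index n")
      case True
      then obtain i j where "p = (i, j)" "1 \<le> i" "i \<le> j" "j \<le> n" by (auto simp: GT_index_def)
      then show ?thesis using GT_entry_eq_sum[OF xy(1)] GT_entry_eq_sum[OF xy(2)] xy(3) by simp
    next
      case False
      then show ?thesis
        using xy(1,2)[THEN affine_hull_GT_polytope(1)] by (simp add: coord_spaceD)
    qed
  qed
  show "x \<in> coord_lattice (GT_index n) \<longleftrightarrow> GT_flow n x \<in> coord_lattice (arcs (GT_network n))"
    if x: "x \<in> affine hull GT_polytope n lam" for x
  proof
    assume "x \<in> coord_lattice (GT_index n)"
    \<comment> \<open>Every arc value is a difference of two entries, hence an integer.\<close>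
    then have "arc_value n (Poly_Mapping.lookup x) e \<in> \<int>" for e
      by (auto simp: coord_lattice_def arc_value_def split: prod.splits)
    then show "GT_flow n x \<in> coord_lattice (arcs (GT_network n))"
      by (auto simp: coord_lattice_def coord_space_iff lookup_GT_flow when_def)
  next
    assume flow: "GT_flow n x \<in> coord_lattice (arcs (GT_network n))"
    have "Poly_Mapping.lookup x p \<in> \<int>" for p
    proof (cases "p \<in> GT_index n")
      case True
      then obtain i j where "p = (i, j)" "1 \<le> i" "i \<le> j" "j \<le> n" by (auto simp: GT_index_def)
      \<comment> \<open>Conversely, an entry is an integral part plus a sum of integral
        flows.\<close>
      then have "Poly_Mapping.lookup x p =
          real (lam j) + (\<Sum>k\<in>{1..<i}. Poly_Mapping.lookup (GT_flow n x) (diag_arc k (j - 1)))"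
        using GT_entry_eq_sum[OF x] by blast
      moreover have "Poly_Mapping.lookup (GT_flow n x) e \<in> \<int>" for e
        using flow unfolding coord_lattice_def by blast
      ultimately show ?thesis by (simp only: Ints_add Ints_of_nat Ints_sum)
    next
      case False
      then show ?thesis using affine_hull_GT_polytope(1)[OF x] by (simp add: coord_spaceD)
    qed
    then show "x \<in> coord_lattice (GT_index n)"
      using affine_hull_GT_polytope(1)[OF x] by (simp add: coord_lattice_def)
  qed
qed

end
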